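(* Let $\phi(z)=\frac{az+b}{cz+d}$, with $a,b,c,d\in\mathbb{C}$ and $ad-bc\neq 0$, be a linear fractional self-map of $\mathbb{D}$ such that $a=0$ and $\phi(0)\neq 0$. Then $C_\phi$ is not 2-complex symmetric with $J$ on $H^2(\mathbb{D})$.
   Context: $H^2(\mathbb{D})$ is the Hardy space of analytic functions $f$ on the open unit disk $\mathbb{D}\subset\mathbb{C}$ with $\|f\|^2=\sup_{0<r<1}\frac{1}{2\pi}\int_0^{2\pi}|f(re^{i\theta})|^2d\theta<\infty$, a Hilbert space. For an analytic self-map $\phi$ of $\mathbb{D}$, the composition operator $C_\phi$ is the bounded operator on $H^2(\mathbb{D})$ given by $C_\phi f=f\circ\phi$. $J$ is the conjugation on $H^2(\mathbb{D})$ given by $(Jf)(z)=\overline{f(\bar z)}$. A bounded linear operator $T$ on $H^2(\mathbb{D})$ is said to be 2-complex symmetric with $J$ if $JT^2J-2T^*JTJ+(T^* )^2=0$ (equivalently $JT^2-2T^*JT+(T^* )^2J=0$). A linear fractional self-map of $\mathbb{D}$ is a map $z\mapsto\frac{az+b}{cz+d}$ with $ad-bc\ne0$ that is analytic on $\mathbb{D}$ and maps $\mathbb{D}$ into $\mathbb{D}$. *)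

theory Defs
  imports "HOL-Complex_Analysis.Complex_Analysis"
begin

abbreviation unit_disc :: "complex set" where
  "unit_disc \<equiv> ball 0 1"

definition circle_mean :: "(complex \<Rightarrow> complex) \<Rightarrow> real \<Rightarrow> real" where
  "circle_mean f r =
     1 / (2 * pi) * integral {0..2 * pi} (\<lambda>t. (cmod (f (of_real r * cis t)))\<^sup>2)"

text \<open>
  A function on the unit disc is represented by its extension by zero to the complex
  plane. Equality of elements of \<open>hardy_space\<close> is thus equality as functions on the disc.
\<close>

definition hardy_space :: "(complex \<Rightarrow> complex) set" where
  "hardy_space =
     {f. f holomorphic_on unit_disc \<and> bdd_above (circle_mean f ` {0<..<1}) \<and>
         (\<forall>z. z \<notin> unit_disc \<longrightarrow> f z = 0)}"

text \<open>
  The inner product (linear in the first argument) that induces the norm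
  \<open>sqrt (SUP r\<in>{0<..<1}. circle_mean f r)\<close>. The mean \<open>circle_mean f r\<close> increases with \<open>r\<close>,
  so for \<open>g = f\<close> the limit is that supremum; by polarization the limit exists for all
  \<open>f\<close> and \<open>g\<close> in \<open>hardy_space\<close>.
\<close>

definition hardy_inner :: "(complex \<Rightarrow> complex) \<Rightarrow> (complex \<Rightarrow> complex) \<Rightarrow> complex" where
  "hardy_inner f g =
     Lim (at_left (1::real))
       (\<lambda>r. 1 / (2 * of_real pi) *
            integral {0..2 * pi} (\<lambda>t. f (of_real r * cis t) * cnj (g (of_real r * cis t))))"

text \<open>
  If \<open>T\<close> is a bounded linear operator on \<open>hardy_space\<close>, then for \<open>g\<close> in \<open>hardy_space\<close> the
  vector \<open>h\<close> below exists and is unique by the Riesz representation theorem.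
\<close>

definition hardy_adjoint ::
    "((complex \<Rightarrow> complex) \<Rightarrow> complex \<Rightarrow> complex) \<Rightarrow> (complex \<Rightarrow> complex) \<Rightarrow> complex \<Rightarrow> complex" where
  "hardy_adjoint T g =
     (THE h. h \<in> hardy_space \<and> (\<forall>f\<in>hardy_space. hardy_inner (T f) g = hardy_inner f h))"

definition hardy_conj :: "(complex \<Rightarrow> complex) \<Rightarrow> complex \<Rightarrow> complex" where
  "hardy_conj f = (\<lambda>z. cnj (f (cnj z)))"

definition composition_operator ::
    "(complex \<Rightarrow> complex) \<Rightarrow> (complex \<Rightarrow> complex) \<Rightarrow> complex \<Rightarrow> complex" where
  "composition_operator \<phi> f = (\<lambda>z. if z \<in> unit_disc then f (\<phi> z) else 0)"

text \<open>
  The identity \<open>J T\<^sup>2 J - 2 T* J T J + (T*)\<^sup>2 = 0\<close>, where \<open>T*\<close> is the adjoint of \<open>T\<close>;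
  meant for bounded linear operators \<open>T\<close> on \<open>hardy_space\<close>.
\<close>

definition two_complex_symmetric ::
    "((complex \<Rightarrow> complex) \<Rightarrow> complex \<Rightarrow> complex) \<Rightarrow>
     ((complex \<Rightarrow> complex) \<Rightarrow> complex \<Rightarrow> complex) \<Rightarrow> bool" where
  "two_complex_symmetric J T \<longleftrightarrow>
     (\<forall>f\<in>hardy_space. \<forall>z\<in>unit_disc.
        J (T (T (J f))) z - 2 * hardy_adjoint T (J (T (J f))) z
          + hardy_adjoint T (hardy_adjoint T f) z = 0)"

definition linear_fractional ::
    "complex \<Rightarrow> complex \<Rightarrow> complex \<Rightarrow> complex \<Rightarrow> complex \<Rightarrow> complex" where
  "linear_fractional a b c d z = (a * z + b) / (c * z + d)"

text \<open>
  Division by zero is total, but when \<open>a * d - b * c \<noteq> 0\<close> a zero of \<open>c * z + d\<close> in the disc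
  is a genuine pole, at which the quotient is discontinuous; holomorphy excludes it.
\<close>

definition lf_self_map :: "complex \<Rightarrow> complex \<Rightarrow> complex \<Rightarrow> complex \<Rightarrow> bool" where
  "lf_self_map a b c d \<longleftrightarrow>
     a * d - b * c \<noteq> 0 \<and>
     linear_fractional a b c d holomorphic_on unit_disc \<and>
     linear_fractional a b c d ` unit_disc \<subseteq> unit_disc"

end

theory Submission
  imports Defs
begin

text \<open>
  Let \<open>K w\<close> be the reproducing kernel of the Hardy space at \<open>w\<close>. The adjoint of the
  composition operator with symbol \<open>\<phi>\<close> maps \<open>K w\<close> to \<open>K (\<phi> w)\<close>, and \<open>K 0\<close> is the constant
  function 1, which is fixed by \<open>J\<close> and by the composition operator. So the identity of 2-complex
  symmetry applied to \<open>K 0\<close> reads \<open>1 - 2 K (\<phi> 0) + K (\<phi> (\<phi> 0)) = 0\<close>. With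
  \<open>s = cnj (\<phi> 0)\<close> and \<open>t = cnj (\<phi> (\<phi> 0))\<close>, clearing denominators gives
  \<open>(t - 2 s) z + s t z\<^sup>2 = 0\<close> on the disc, and hence \<open>s = 0\<close>.
\<close>

text \<open>The value 0 off the disc matches the extension by zero that \<open>hardy_space\<close>
  prescribes for its elements.\<close>

definition hardy_kernel :: "complex \<Rightarrow> complex \<Rightarrow> complex" where
  "hardy_kernel w z = (if z \<in> unit_disc then 1 / (1 - cnj w * z) else 0)"

lemma one_minus_cnj_mult_nonzero:
  assumes "w \<in> unit_disc" "z \<in> unit_disc"
  shows "1 - cnj w * z \<noteq> 0"
proof
  assume "1 - cnj w * z = 0"
  then have "cmod (cnj w * z) = 1" by (metis eq_iff_diff_eq_0 norm_one)
  then have "cmod w * cmod z = 1" by (simp add: norm_mult)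
  moreover have "cmod w * cmod z < 1 * 1"
    using assms by (intro mult_strict_mono') auto
  ultimately show False by simp
qed

lemma hardy_kernel_holomorphic:
  assumes "w \<in> unit_disc"
  shows "hardy_kernel w holomorphic_on unit_disc"
proof -
  have "(\<lambda>z. 1 / (1 - cnj w * z)) holomorphic_on unit_disc"
    using one_minus_cnj_mult_nonzero[OF assms] by (intro holomorphic_intros) auto
  then show ?thesis
    by (rule holomorphic_transform) (simp add: hardy_kernel_def)
qed

text \<open>The reverse triangle inequality bounds the denominator below by
  \<open>1 - cmod w\<close>. The bound is uniform in \<open>z\<close>, so it also bounds the circle
  means and puts the kernel in \<open>hardy_space\<close>.\<close>

lemma hardy_kernel_cmod_le:
  assumes "w \<in> unit_disc"
  shows "cmod (hardy_kernel w z) \<le> 1 / (1 - cmod w)"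
proof (cases "z \<in> unit_disc")
  case True
  have "cmod w * cmod z \<le> cmod w * 1"
    using True by (intro mult_left_mono) auto
  then have "1 - cmod w \<le> cmod (1 - cnj w * z)"
    using norm_triangle_ineq2[of 1 "cnj w * z"] by (simp add: norm_mult)
  then show ?thesis
    using True assms by (simp add: hardy_kernel_def norm_divide frac_le)
qed (use assms in \<open>simp add: hardy_kernel_def\<close>)

lemma circle_mean_le:
  assumes "continuous_on unit_disc f" "\<And>z. cmod (f z) \<le> B" "r \<in> {0<..<1}"
  shows "circle_mean f r \<le> B\<^sup>2"
proof -
  have "integral {0..2 * pi} (\<lambda>t. (cmod (f (of_real r * cis t)))\<^sup>2) \<le> integral {0..2 * pi} (\<lambda>t. B\<^sup>2)"
  proof (intro integral_le integrable_continuous_real continuous_intros)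
    show "continuous_on {0..2 * pi} (\<lambda>t. f (of_real r * cis t))"
      using assms by (intro continuous_on_compose2[OF assms(1)] continuous_intros)
        (auto simp: norm_mult)
    show "(cmod (f (of_real r * cis t)))\<^sup>2 \<le> B\<^sup>2" for t
      using assms(2) by (intro power_mono) auto
  qed
  then show ?thesis
    by (simp add: circle_mean_def field_simps)
qed

lemma hardy_kernel_in_hardy_space:
  assumes "w \<in> unit_disc"
  shows "hardy_kernel w \<in> hardy_space"
proof -
  have "bdd_above (circle_mean (hardy_kernel w) ` {0<..<1})"
    using circle_mean_le[OF holomorphic_on_imp_continuous_on[OF hardy_kernel_holomorphic[OF assms]]
        hardy_kernel_cmod_le[OF assms]]
    by (intro bdd_aboveI2) blast
  then show ?thesis
    using hardy_kernel_holomorphic[OF assms] by (simp add: hardy_space_def hardy_kernel_def)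
qed

text \<open>This is Cauchy's integral formula in disguise: on the circle of radius \<open>r\<close>
  one has \<open>cnj z = r\<^sup>2 / z\<close>, so the conjugated kernel equals
  \<open>z / (z - r\<^sup>2 * w)\<close> there.\<close>

lemma has_integral_mult_cnj_hardy_kernel:
  assumes f: "f holomorphic_on unit_disc" and w: "w \<in> unit_disc" and r: "r \<in> {0<..<1}"
  shows "((\<lambda>t. f (of_real r * cis t) * cnj (hardy_kernel w (of_real r * cis t)))
           has_integral 2 * of_real pi * f (of_real (r\<^sup>2) * w)) {0..2 * pi}"
proof -
  \<comment> \<open>The pole \<open>v\<close> lies inside the circle because
    \<open>r * cmod w < 1\<close>.\<close>
  define v where "v = of_real (r\<^sup>2) * w"
  have "r * (r * cmod w) < r * 1"
    using r w mult_strict_mono'[of r 1 "cmod w" 1] by (intro mult_strict_left_mono) auto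
  then have v: "cmod (v - 0) < r"
    by (simp add: v_def norm_mult power2_eq_square)
  have disc: "cball 0 r \<subseteq> unit_disc"
    using r by auto
  have "((\<lambda>z. f z / (z - v)) has_contour_integral 2 * of_real pi * \<i> * f v) (circlepath 0 r)"
  proof (rule Cauchy_integral_circlepath)
    show "continuous_on (cball 0 r) f"
      using f disc holomorphic_on_imp_continuous_on holomorphic_on_subset by blast
    show "f holomorphic_on ball 0 r"
      using f disc ball_subset_cball holomorphic_on_subset by blast
  qed (use v in simp)
  then have "((\<lambda>t. f (0 + of_real r * cis t) / (0 + of_real r * cis t - v) * of_real r * \<i> * cis t)
              has_integral 2 * of_real pi * \<i> * f v) {0..2 * pi}"
    unfolding circlepath_def by (subst (asm) has_contour_integral_part_circlepath_iff) auto
  \<comment> \<open>The factor \<open>- \<i>\<close> cancels the \<open>\<i>\<close> in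
    \<open>dz = \<i> * z dt\<close>; the remaining \<open>z\<close> is the numerator of the
    conjugated kernel.\<close>
  then have *: "((\<lambda>t. - \<i> * (f (0 + of_real r * cis t) / (0 + of_real r * cis t - v) * of_real r * \<i> * cis t))
              has_integral - \<i> * (2 * of_real pi * \<i> * f v)) {0..2 * pi}"
    by (rule has_integral_mult_right)
  have ii: "\<i> * (x * \<i>) = - x" for x
    by (simp add: complex_eq_iff)
  have "- \<i> * (f (0 + of_real r * cis t) / (0 + of_real r * cis t - v) * of_real r * \<i> * cis t)
      = f (of_real r * cis t) * cnj (hardy_kernel w (of_real r * cis t))" for t
  proof -
    have z: "of_real r * cis t \<in> unit_disc"
      using r by (simp add: norm_mult)
    have "cnj (1 - cnj w * (of_real r * cis t)) \<noteq> 0"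
      using one_minus_cnj_mult_nonzero[OF w z] by (simp only: complex_cnj_zero_iff not_False_eq_True)
    then have n: "1 - w * (of_real r * cnj (cis t)) \<noteq> 0"
      by simp
    have c: "cis t * cnj (cis t) = 1"
      by (simp add: cis_cnj cis_mult)
    have "of_real r * cis t - v = of_real r * cis t * (1 - w * (of_real r * cnj (cis t)))"
      using c by (simp add: v_def algebra_simps power2_eq_square)
    then show ?thesis
      using z n r by (simp add: hardy_kernel_def ii)
  qed
  then show ?thesis
    using * ii[of "2 * of_real pi * f v"] by (simp add: v_def mult_ac)
qed

lemma tendsto_hardy_mean:
  assumes f: "f holomorphic_on unit_disc" and w: "w \<in> unit_disc"
  shows "((\<lambda>r. f (of_real (r\<^sup>2) * w)) \<longlongrightarrow> f w) (at_left (1::real))"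
proof -
  have "isCont f w"
    using f w holomorphic_on_imp_continuous_on continuous_on_interior[of unit_disc f w] by simp
  moreover have "((\<lambda>r::real. of_real (r\<^sup>2) * w) \<longlongrightarrow> of_real (1\<^sup>2) * w) (at_left 1)"
    by (intro tendsto_intros)
  ultimately show ?thesis
    by (intro isCont_tendsto_compose[of w f]) simp_all
qed

text \<open>Since \<open>hardy_inner\<close> is a \<open>Lim\<close>, it can be evaluated once the
  mean over each circle is known in closed form \<open>m r\<close> and \<open>m\<close> converges as
  \<open>r\<close> tends to 1 from the left.\<close>

lemma hardy_inner_eqI:
  assumes "\<And>r. r \<in> {0<..<1} \<Longrightarrow>
      ((\<lambda>t. f (of_real r * cis t) * cnj (g (of_real r * cis t)))
        has_integral 2 * of_real pi * m r) {0..2 * pi}"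
    and "(m \<longlongrightarrow> l) (at_left 1)"
  shows "hardy_inner f g = l"
proof -
  have "\<forall>\<^sub>F r in at_left (1::real). m r = 1 / (2 * of_real pi) *
      integral {0..2 * pi} (\<lambda>t. f (of_real r * cis t) * cnj (g (of_real r * cis t)))"
    using eventually_at_left_real[OF zero_less_one]
    by (rule eventually_mono) (use integral_unique[OF assms(1)] in auto)
  from Lim_transform_eventually[OF assms(2) this] show ?thesis
    unfolding hardy_inner_def by (intro tendsto_Lim) auto
qed

lemma hardy_inner_kernel_right:
  assumes "f holomorphic_on unit_disc" "w \<in> unit_disc"
  shows "hardy_inner f (hardy_kernel w) = f w"
  using has_integral_mult_cnj_hardy_kernel[OF assms] tendsto_hardy_mean[OF assms]
  by (rule hardy_inner_eqI)

text \<open>Conjugating the integral formula gives the mirrored reproducing property. It serves the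
  uniqueness of adjoint vectors, where kernels are the test functions in the first argument.\<close>

lemma hardy_inner_kernel_left:
  assumes "f holomorphic_on unit_disc" "w \<in> unit_disc"
  shows "hardy_inner (hardy_kernel w) f = cnj (f w)"
proof (rule hardy_inner_eqI)
  show "((\<lambda>t. hardy_kernel w (of_real r * cis t) * cnj (f (of_real r * cis t)))
      has_integral 2 * of_real pi * cnj (f (of_real (r\<^sup>2) * w))) {0..2 * pi}"
    if "r \<in> {0<..<1}" for r
    using has_integral_cnj[THEN iffD2, OF has_integral_mult_cnj_hardy_kernel[OF assms that]]
    by (simp add: o_def mult.commute)
  show "((\<lambda>r. cnj (f (of_real (r\<^sup>2) * w))) \<longlongrightarrow> cnj (f w)) (at_left (1::real))"
    by (intro tendsto_cnj tendsto_hardy_mean assms)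
qed

text \<open>Pairing \<open>f \<circ> \<phi>\<close> with the kernel at \<open>w\<close> gives
  \<open>f (\<phi> w)\<close>, which is \<open>f\<close> paired with the kernel at
  \<open>\<phi> w\<close>.\<close>

lemma hardy_adjoint_composition_kernel:
  assumes \<phi>: "\<phi> holomorphic_on unit_disc" "\<phi> ` unit_disc \<subseteq> unit_disc" and w: "w \<in> unit_disc"
  shows "hardy_adjoint (composition_operator \<phi>) (hardy_kernel w) = hardy_kernel (\<phi> w)"
  unfolding hardy_adjoint_def
proof (rule the_equality)
  have \<phi>w: "\<phi> w \<in> unit_disc"
    using \<phi> w by blast
  have *: "hardy_inner (composition_operator \<phi> f) (hardy_kernel w) = f (\<phi> w)"
    if "f \<in> hardy_space" for f
  proof -
    have "(f \<circ> \<phi>) holomorphic_on unit_disc"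
      using that \<phi> by (auto simp: hardy_space_def intro: holomorphic_on_compose_gen)
    then have "composition_operator \<phi> f holomorphic_on unit_disc"
      by (rule holomorphic_transform) (simp add: composition_operator_def)
    then show ?thesis
      using w by (simp add: hardy_inner_kernel_right composition_operator_def)
  qed
  show "hardy_kernel (\<phi> w) \<in> hardy_space \<and>
      (\<forall>f\<in>hardy_space. hardy_inner (composition_operator \<phi> f) (hardy_kernel w) =
         hardy_inner f (hardy_kernel (\<phi> w)))"
    using * \<phi>w hardy_inner_kernel_right[OF _ \<phi>w] hardy_kernel_in_hardy_space[OF \<phi>w]
    by (simp add: hardy_space_def)
  fix h
  assume h: "h \<in> hardy_space \<and>
      (\<forall>f\<in>hardy_space. hardy_inner (composition_operator \<phi> f) (hardy_kernel w) = hardy_inner f h)"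
  show "h = hardy_kernel (\<phi> w)"
  proof
    fix z
    show "h z = hardy_kernel (\<phi> w) z"
    proof (cases "z \<in> unit_disc")
      case True
      \<comment> \<open>Taking \<open>f = hardy_kernel z\<close> in the adjoint identity recovers
        the value of \<open>h\<close> at \<open>z\<close>, so \<open>h\<close> is determined
        pointwise.\<close>
      then have "cnj (h z) = hardy_kernel z (\<phi> w)"
        using h * hardy_inner_kernel_left[of h z] hardy_kernel_in_hardy_space[of z]
        by (simp add: hardy_space_def)
      then have "h z = cnj (hardy_kernel z (\<phi> w))"
        by (metis complex_cnj_cnj)
      then show ?thesis
        using True \<phi>w by (simp add: hardy_kernel_def mult.commute)
    next
      case False
      then show ?thesis
        using h by (simp add: hardy_space_def hardy_kernel_def)
    qed
  qed
qed

lemma two_complex_symmetric_composition_fixes_0: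
  assumes \<phi>: "\<phi> holomorphic_on unit_disc" "\<phi> ` unit_disc \<subseteq> unit_disc"
    and sym: "two_complex_symmetric hardy_conj (composition_operator \<phi>)"
  shows "\<phi> 0 = 0"
proof -
  define s where "s = cnj (\<phi> 0)"
  define t where "t = cnj (\<phi> (\<phi> 0))"
  have in_disc: "\<phi> 0 \<in> unit_disc" "\<phi> (\<phi> 0) \<in> unit_disc"
    using \<phi>(2) by (auto simp: image_subset_iff simp del: mem_ball mem_ball_0)
  have J: "hardy_conj (hardy_kernel 0) = hardy_kernel 0"
    by (auto simp: hardy_conj_def hardy_kernel_def)
  have C: "composition_operator \<phi> (hardy_kernel 0) = hardy_kernel 0"
    using \<phi>(2) by (simp add: composition_operator_def hardy_kernel_def image_subset_iff fun_eq_iff)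
  have eq: "(t - 2 * s) * z + s * t * z\<^sup>2 = 0" if z: "z \<in> unit_disc" for z
  proof -
    have "hardy_kernel 0 z - 2 * hardy_kernel (\<phi> 0) z + hardy_kernel (\<phi> (\<phi> 0)) z = 0"
      using sym[unfolded two_complex_symmetric_def, rule_format, of "hardy_kernel 0" z] z in_disc \<phi>
      by (simp add: J C hardy_kernel_in_hardy_space hardy_adjoint_composition_kernel)
    then have "1 - 2 / (1 - s * z) + 1 / (1 - t * z) = 0"
      using z by (simp add: hardy_kernel_def s_def t_def)
    moreover have "1 - s * z \<noteq> 0" "1 - t * z \<noteq> 0"
      using one_minus_cnj_mult_nonzero z in_disc by (auto simp: s_def t_def)
    ultimately have "(1 - s * z) * (1 - t * z) - 2 * (1 - t * z) + (1 - s * z) = 0"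
      by (simp add: divide_simps) (simp add: algebra_simps)
    then show ?thesis
      by (simp add: algebra_simps power2_eq_square)
  qed
  \<comment> \<open>Two opposite points of the disc separate the linear from the quadratic
    coefficient. Both vanish, so \<open>t = 2 * s\<close> and \<open>s * t = 0\<close>, which forces
    \<open>s = 0\<close>.\<close>
  have "2 * (t - 2 * s) + s * t = 0" "- 2 * (t - 2 * s) + s * t = 0"
    using eq[of "1 / 2"] eq[of "- (1 / 2)"] by (simp_all add: power2_eq_square field_simps)
  then have "2 * (s * t) = 0" "4 * (t - 2 * s) = 0"
    by algebra+
  then have "s = 0" by auto
  then show ?thesis by (simp add: s_def)
qed

theorem theorem5:
  fixes a b c d :: complex
  assumes "lf_self_map a b c d"
    and "a = 0"
    and "linear_fractional a b c d 0 \<noteq> 0"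
  shows "\<not> two_complex_symmetric hardy_conj (composition_operator (linear_fractional a b c d))"
  using assms two_complex_symmetric_composition_fixes_0 unfolding lf_self_map_def by blast

end
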